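(* Let $(\mathcal{B},\mathcal{L})$ be a Floer space. Let $\sigma:P\to\mathcal{B}$ be a semi-infinite cycle for $(\mathcal{B},\mathcal{L})$ and let $\tau:Q\to\mathcal{B}$ be a semi-infinite cycle for $(-\mathcal{B},-\mathcal{L})$. Then $$P\cap Q=\{(p,q)\in P\times Q:\sigma(p)=\tau(q)\}$$ is compact.
   Context: **Polarization.** Let $\mathcal{B}$ be a separable Hilbert manifold. A polarizing chart over an open set $U\subset\mathcal{B}$ is a bundle isomorphism $\phi:T^+(U)\oplus T^-(U)\cong T(U)$, where $T^\pm(U)$ are closed infinite-dimensional subbundles of $T(U)=T\mathcal{B}|_U$; $\pi^\pm:T(U)\to T^\pm(U)$ are the induced projections. Two charts $\phi_i,\phi_j$ are compatible if over $U_i\cap U_j$ the maps $\pi^\pm\circ\phi_j^{-1}\phi_i:T_i^\pm\to T_j^\pm$ are Fredholm and $\pi^\mp\circ\phi_j^{-1}\phi_i:T_i^\pm\to T_j^\mp$ are compact. A polarization is a maximal compatible atlas. **Floer space.** A Floer space $(\mathcal{B},\mathcal{L})$ consists of a separable Hilbert manifold $\mathcal{B}$ with a choice of a weak topology coarser than the ordinary (strong) topology, a polarization of $\mathcal{B}$, and a functional $\mathcal{L}:\mathcal{B}\to\mathbb{R}$ continuous in the ordinary topology. $(-\mathcal{B},-\mathcal{L})$ is the Floer space obtained by changing the sign of $\mathcal{L}$ and exchanging the roles of $T^+$ and $T^-$ (same manifold, same weak topology). **Cycles.** A smooth map $\sigma:P\to\mathcal{B}$ from a separable Hilbert manifold $P$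 (possibly with boundary) is a semi-infinite cycle for $(\mathcal{B},\mathcal{L})$ if: (1) $\mathcal{L}$ is bounded above on $\mathrm{im}(\sigma)$, and if $y_i\in\mathrm{im}(\sigma)$ converges weakly to $z\in\mathcal{B}$ then $\liminf\mathcal{L}(y_i)\le\mathcal{L}(z)$; (2) if $y_i\in\mathrm{im}(\sigma)$ and $\mathcal{L}(y_i)$ is uniformly bounded, then $y_i$ has a subsequence converging weakly in $\mathcal{B}$; (3) if $y_i=\sigma(p_i)$ converges weakly to $z\in\mathcal{B}$ and $\lim\mathcal{L}(y_i)=\mathcal{L}(z)$, then $p_i$ has a convergent subsequence in $P$; (4) for each $p\in P$ and each polarizing chart of the polarization around $\sigma(p)$, $\pi^-\circ D\sigma_p$ is Fredholm and $\pi^+\circ D\sigma_p$ is compact. *)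

theory Defs
  imports "HOL-Analysis.Analysis"
begin

section \<open>Smooth maps between subsets of normed spaces\<close>

definition bounded_multilinear ::
  "nat \<Rightarrow> ('a::real_normed_vector list \<Rightarrow> 'b::real_normed_vector) \<Rightarrow> bool" where
  "bounded_multilinear k T \<longleftrightarrow>
     (\<forall>vs i. length vs = k \<longrightarrow> i < k \<longrightarrow> linear (\<lambda>v. T (vs[i := v]))) \<and>
     (\<exists>K. \<forall>vs. length vs = k \<longrightarrow> norm (T vs) \<le> K * prod_list (map norm vs))"

text \<open>
  The k-th Frechet derivative takes values in the normed space of bounded k-linear maps, which is a
  different type for every k.  Here \<open>D k x\<close> is that derivative at \<open>x\<close>, acting on lists of length k;
  the last clause says that \<open>D (Suc k) x\<close> is the Frechet derivative of \<open>D k\<close> at \<open>x\<close> with respect to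
  the operator norm on k-linear maps.
\<close>
definition smooth_on_open ::
  "'a::real_normed_vector set \<Rightarrow> ('a \<Rightarrow> 'b::real_normed_vector) \<Rightarrow> bool" where
  "smooth_on_open U f \<longleftrightarrow> open U \<and>
     (\<exists>D. (\<forall>x\<in>U. D 0 x [] = f x) \<and>
          (\<forall>k. \<forall>x\<in>U. bounded_multilinear k (D k x)) \<and>
          (\<forall>k. \<forall>x\<in>U. \<forall>\<epsilon>>0. \<exists>\<delta>>0. \<forall>h. norm h < \<delta> \<longrightarrow> x + h \<in> U \<longrightarrow>
             (\<forall>vs. length vs = k \<longrightarrow>
                norm (D k (x + h) vs - D k x vs - D (Suc k) x (h # vs))
                  \<le> \<epsilon> * norm h * prod_list (map norm vs))))"

text \<open>On a set that need not be open (a relatively open part of a half-space, say), smooth means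
  locally extendable to a smooth map on an open set.\<close>
definition smooth_on ::
  "'a::real_normed_vector set \<Rightarrow> ('a \<Rightarrow> 'b::real_normed_vector) \<Rightarrow> bool" where
  "smooth_on S f \<longleftrightarrow>
     (\<forall>x\<in>S. \<exists>V g. x \<in> V \<and> smooth_on_open V g \<and> (\<forall>y\<in>V \<inter> S. g y = f y))"

section \<open>Separable Hilbert manifolds\<close>

type_synonym ('m, 'e) chart = "'m set \<times> ('m \<Rightarrow> 'e)"

abbreviation cdom :: "('m, 'e) chart \<Rightarrow> 'm set" where "cdom c \<equiv> fst c"
abbreviation cmap :: "('m, 'e) chart \<Rightarrow> 'm \<Rightarrow> 'e" where "cmap c \<equiv> snd c"
abbreviation cran :: "('m, 'e) chart \<Rightarrow> 'e set" where "cran c \<equiv> cmap c ` cdom c"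
abbreviation cinv :: "('m, 'e) chart \<Rightarrow> 'e \<Rightarrow> 'm" where "cinv c \<equiv> inv_into (cdom c) (cmap c)"

record ('m, 'e) manifold =
  mtop :: "'m topology"
  matlas :: "('m, 'e) chart set"

abbreviation mcarrier :: "('m, 'e, 'z) manifold_scheme \<Rightarrow> 'm set" where
  "mcarrier M \<equiv> topspace (mtop M)"

definition charts_at :: "('m, 'e) manifold \<Rightarrow> 'm \<Rightarrow> ('m, 'e) chart set" where
  "charts_at M x = {c \<in> matlas M. x \<in> cdom c}"

definition smooth_at_charts ::
  "('m, 'e::real_normed_vector) chart \<Rightarrow> ('n, 'f::real_normed_vector) chart \<Rightarrow> ('m \<Rightarrow> 'n) \<Rightarrow> bool"
  where
  "smooth_at_charts c d f \<longleftrightarrow>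
     smooth_on (cmap c ` {x \<in> cdom c. f x \<in> cdom d}) (cmap d \<circ> f \<circ> cinv c)"

text \<open>
  A closed half-space of the model Hilbert space has the form \<open>{v. 0 \<le> u \<bullet> v}\<close> with \<open>u \<noteq> 0\<close>;
  \<open>u = 0\<close> gives the whole space.  The boundary may be empty.  ``Separable'' is rendered by second
  countability, of the manifold and (through the sort constraint) of the model Hilbert space.
\<close>
definition hilbert_manifold_with_boundary ::
  "('m, 'e::{real_inner, complete_space, second_countable_topology}) manifold \<Rightarrow> bool" where
  "hilbert_manifold_with_boundary M \<longleftrightarrow>
     Hausdorff_space (mtop M) \<and> second_countable (mtop M) \<and>
     \<Union> (cdom ` matlas M) = mcarrier M \<and>
     (\<forall>c\<in>matlas M.
        openin (mtop M) (cdom c) \<and>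
        homeomorphic_map (subtopology (mtop M) (cdom c)) (top_of_set (cran c)) (cmap c) \<and>
        (\<exists>u. openin (top_of_set {v. 0 \<le> u \<bullet> v}) (cran c))) \<and>
     (\<forall>c\<in>matlas M. \<forall>d\<in>matlas M. smooth_at_charts c d id)"

definition hilbert_manifold ::
  "('m, 'e::{real_inner, complete_space, second_countable_topology}) manifold \<Rightarrow> bool" where
  "hilbert_manifold M \<longleftrightarrow>
     hilbert_manifold_with_boundary M \<and> (\<forall>c\<in>matlas M. open (cran c))"

definition smooth_manifold_map ::
  "('m, 'e::real_normed_vector) manifold \<Rightarrow> ('n, 'f::real_normed_vector) manifold
     \<Rightarrow> ('m \<Rightarrow> 'n) \<Rightarrow> bool" where
  "smooth_manifold_map M N f \<longleftrightarrow>
     continuous_map (mtop M) (mtop N) f \<and>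
     (\<forall>c\<in>matlas M. \<forall>d\<in>matlas N. smooth_at_charts c d f)"

section \<open>Tangent spaces and differentials\<close>

text \<open>The derivative within \<open>cran c\<close> is unique also at boundary points, \<open>cran c\<close> being relatively
  open in a half-space.\<close>
definition coord_deriv ::
  "('m, 'e::real_normed_vector) chart \<Rightarrow> ('n, 'f::real_normed_vector) chart \<Rightarrow> ('m \<Rightarrow> 'n)
     \<Rightarrow> 'm \<Rightarrow> 'e \<Rightarrow> 'f" where
  "coord_deriv c d f x =
     frechet_derivative (cmap d \<circ> f \<circ> cinv c) (at (cmap c x) within cran c)"

text \<open>
  A tangent vector at \<open>x\<close> is the family of its coordinate vectors in the charts around \<open>x\<close>, related
  by the derivatives of the coordinate changes; the value at all other charts is fixed to be 0.  For
  a chart \<open>c\<close> around \<open>x\<close>, evaluation \<open>v \<mapsto> v c\<close> identifies the tangent space with the model space, and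
  \<open>tvec M x c\<close> is the inverse identification.
\<close>
type_synonym ('m, 'e) tangent = "('m, 'e) chart \<Rightarrow> 'e"

definition tangent_space ::
  "('m, 'e::real_normed_vector) manifold \<Rightarrow> 'm \<Rightarrow> ('m, 'e) tangent set" where
  "tangent_space M x =
     {v. (\<forall>c\<in>charts_at M x. \<forall>d\<in>charts_at M x. v d = coord_deriv c d id x (v c)) \<and>
         (\<forall>c. c \<notin> charts_at M x \<longrightarrow> v c = 0)}"

definition tvec ::
  "('m, 'e::real_normed_vector) manifold \<Rightarrow> 'm \<Rightarrow> ('m, 'e) chart \<Rightarrow> 'e \<Rightarrow> ('m, 'e) tangent" where
  "tvec M x c e = (\<lambda>d. if d \<in> charts_at M x then coord_deriv c d id x e else 0)"

definition tzero :: "('m, 'e::real_normed_vector) tangent" where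
  "tzero = (\<lambda>_. 0)"

text \<open>The value does not depend on the chart \<open>c\<close> chosen around \<open>p\<close>.\<close>
definition differential ::
  "('m, 'e::real_normed_vector) manifold \<Rightarrow> ('n, 'f::real_normed_vector) manifold \<Rightarrow> ('m \<Rightarrow> 'n)
     \<Rightarrow> 'm \<Rightarrow> ('m, 'e) tangent \<Rightarrow> ('n, 'f) tangent" where
  "differential M N f p v =
     (\<lambda>d. if d \<in> charts_at N (f p)
          then (let c = (SOME c. c \<in> charts_at M p) in coord_deriv c d f p (v c)) else 0)"

section \<open>Fredholm and compact operators\<close>

definition finite_dimensional :: "'a::real_vector set \<Rightarrow> bool" where
  "finite_dimensional S \<longleftrightarrow> (\<exists>B. finite B \<and> S \<subseteq> span B)"

definition bounded_operator ::
  "'a::real_normed_vector set \<Rightarrow> 'b::real_normed_vector set \<Rightarrow> ('a \<Rightarrow> 'b) \<Rightarrow> bool" where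
  "bounded_operator V W T \<longleftrightarrow>
     T ` V \<subseteq> W \<and>
     (\<forall>u\<in>V. \<forall>v\<in>V. T (u + v) = T u + T v) \<and>
     (\<forall>r. \<forall>v\<in>V. T (r *\<^sub>R v) = r *\<^sub>R T v) \<and>
     (\<exists>K. \<forall>v\<in>V. norm (T v) \<le> K * norm v)"

definition fredholm_operator ::
  "'a::real_normed_vector set \<Rightarrow> 'b::real_normed_vector set \<Rightarrow> ('a \<Rightarrow> 'b) \<Rightarrow> bool" where
  "fredholm_operator V W T \<longleftrightarrow>
     bounded_operator V W T \<and>
     finite_dimensional {v \<in> V. T v = 0} \<and>
     closed (T ` V) \<and>
     (\<exists>B. finite B \<and> B \<subseteq> W \<and> W \<subseteq> span (T ` V \<union> B))"

definition compact_operator ::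
  "'a::real_normed_vector set \<Rightarrow> 'b::real_normed_vector set \<Rightarrow> ('a \<Rightarrow> 'b) \<Rightarrow> bool" where
  "compact_operator V W T \<longleftrightarrow>
     bounded_operator V W T \<and> compact (closure (T ` (V \<inter> cball 0 1)))"

text \<open>
  Operators between subspaces \<open>V\<close> of the tangent space at \<open>x\<close> and \<open>W\<close> of the tangent space at \<open>y\<close>.
  Tangent spaces are only normed up to equivalence, so the notions above are applied to the
  coordinate expressions of \<open>V\<close>, \<open>W\<close> and \<open>T\<close>.
\<close>
definition tangent_fredholm ::
  "('m, 'e::real_normed_vector) manifold \<Rightarrow> 'm \<Rightarrow> ('m, 'e) tangent set \<Rightarrow>
   ('n, 'f::real_normed_vector) manifold \<Rightarrow> 'n \<Rightarrow> ('n, 'f) tangent set \<Rightarrow>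
   (('m, 'e) tangent \<Rightarrow> ('n, 'f) tangent) \<Rightarrow> bool" where
  "tangent_fredholm M x V N y W T \<longleftrightarrow>
     (\<forall>c\<in>charts_at M x. \<forall>d\<in>charts_at N y.
        fredholm_operator ((\<lambda>v. v c) ` V) ((\<lambda>w. w d) ` W) (\<lambda>e. T (tvec M x c e) d))"

definition tangent_compact ::
  "('m, 'e::real_normed_vector) manifold \<Rightarrow> 'm \<Rightarrow> ('m, 'e) tangent set \<Rightarrow>
   ('n, 'f::real_normed_vector) manifold \<Rightarrow> 'n \<Rightarrow> ('n, 'f) tangent set \<Rightarrow>
   (('m, 'e) tangent \<Rightarrow> ('n, 'f) tangent) \<Rightarrow> bool" where
  "tangent_compact M x V N y W T \<longleftrightarrow>
     (\<forall>c\<in>charts_at M x. \<forall>d\<in>charts_at N y.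
        compact_operator ((\<lambda>v. v c) ` V) ((\<lambda>w. w d) ` W) (\<lambda>e. T (tvec M x c e) d))"

section \<open>Polarizations\<close>

text \<open>
  The subbundle is locally trivial: near each point there is a smooth family \<open>G\<close> of automorphisms of
  the model space carrying a fixed closed subspace \<open>E\<close> onto the coordinate expression of the fibres.
  (A closed subspace of a Hilbert space is complemented, so this is the splitting notion.)
\<close>
definition closed_subbundle ::
  "('m, 'e::{real_inner, complete_space, second_countable_topology}) manifold \<Rightarrow> 'm set
     \<Rightarrow> ('m \<Rightarrow> ('m, 'e) tangent set) \<Rightarrow> bool" where
  "closed_subbundle M U T \<longleftrightarrow>
     (\<forall>x\<in>U. T x \<subseteq> tangent_space M x) \<and>
     (\<forall>x0\<in>U. \<exists>d\<in>charts_at M x0. \<exists>W E. \<exists>G :: 'e \<Rightarrow> 'e \<Rightarrow>\<^sub>L 'e.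
        openin (mtop M) W \<and> x0 \<in> W \<and> W \<subseteq> U \<inter> cdom d \<and>
        subspace E \<and> closed E \<and> smooth_on (cmap d ` W) G \<and>
        (\<forall>x\<in>W. bij (blinfun_apply (G (cmap d x))) \<and>
                (\<lambda>v. v d) ` T x = blinfun_apply (G (cmap d x)) ` E))"

definition infinite_dimensional_fibres ::
  "('m, 'e::real_normed_vector) manifold \<Rightarrow> 'm set \<Rightarrow> ('m \<Rightarrow> ('m, 'e) tangent set) \<Rightarrow> bool" where
  "infinite_dimensional_fibres M U T \<longleftrightarrow>
     (\<forall>x\<in>U. \<forall>d\<in>charts_at M x. \<not> finite_dimensional ((\<lambda>v. v d) ` T x))"

record ('m, 'e) pol_chart =
  pdom :: "'m set"
  Tplus :: "'m \<Rightarrow> ('m, 'e) tangent set"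
  Tminus :: "'m \<Rightarrow> ('m, 'e) tangent set"
  piso :: "'m \<Rightarrow> ('m, 'e) tangent \<times> ('m, 'e) tangent \<Rightarrow> ('m, 'e) tangent"

text \<open>
  \<open>piso \<phi> x\<close> is a bijection from the (external) direct sum of the two fibres onto the tangent space.
  In coordinates it and its inverse are restrictions of smooth families \<open>A\<close> and \<open>B\<close> of bounded linear
  operators; in particular it is a linear homeomorphism on each fibre.
\<close>
definition polarizing_chart ::
  "('m, 'e::{real_inner, complete_space, second_countable_topology}) manifold
     \<Rightarrow> ('m, 'e) pol_chart \<Rightarrow> bool" where
  "polarizing_chart M \<phi> \<longleftrightarrow>
     openin (mtop M) (pdom \<phi>) \<and>
     closed_subbundle M (pdom \<phi>) (Tplus \<phi>) \<and> infinite_dimensional_fibres M (pdom \<phi>) (Tplus \<phi>) \<and>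
     closed_subbundle M (pdom \<phi>) (Tminus \<phi>) \<and> infinite_dimensional_fibres M (pdom \<phi>) (Tminus \<phi>) \<and>
     (\<forall>x\<in>pdom \<phi>. bij_betw (piso \<phi> x) (Tplus \<phi> x \<times> Tminus \<phi> x) (tangent_space M x)) \<and>
     (\<forall>x0\<in>pdom \<phi>. \<exists>d\<in>charts_at M x0. \<exists>W.
        \<exists>A :: 'e \<Rightarrow> ('e \<times> 'e) \<Rightarrow>\<^sub>L 'e. \<exists>B :: 'e \<Rightarrow> 'e \<Rightarrow>\<^sub>L ('e \<times> 'e).
          openin (mtop M) W \<and> x0 \<in> W \<and> W \<subseteq> pdom \<phi> \<inter> cdom d \<and>
          smooth_on (cmap d ` W) A \<and> smooth_on (cmap d ` W) B \<and>
          (\<forall>x\<in>W. \<forall>v\<in>Tplus \<phi> x. \<forall>w\<in>Tminus \<phi> x.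
             piso \<phi> x (v, w) d = blinfun_apply (A (cmap d x)) (v d, w d) \<and>
             (v d, w d) = blinfun_apply (B (cmap d x)) (piso \<phi> x (v, w) d)))"

definition piso_inv ::
  "('m, 'e) pol_chart \<Rightarrow> 'm \<Rightarrow> ('m, 'e) tangent \<Rightarrow> ('m, 'e) tangent \<times> ('m, 'e) tangent" where
  "piso_inv \<phi> x = inv_into (Tplus \<phi> x \<times> Tminus \<phi> x) (piso \<phi> x)"

definition pi_plus :: "('m, 'e) pol_chart \<Rightarrow> 'm \<Rightarrow> ('m, 'e) tangent \<Rightarrow> ('m, 'e) tangent" where
  "pi_plus \<phi> x t = fst (piso_inv \<phi> x t)"

definition pi_minus :: "('m, 'e) pol_chart \<Rightarrow> 'm \<Rightarrow> ('m, 'e) tangent \<Rightarrow> ('m, 'e) tangent" where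
  "pi_minus \<phi> x t = snd (piso_inv \<phi> x t)"

definition pol_charts_compatible ::
  "('m, 'e::real_normed_vector) manifold \<Rightarrow> ('m, 'e) pol_chart \<Rightarrow> ('m, 'e) pol_chart \<Rightarrow> bool" where
  "pol_charts_compatible M \<phi> \<psi> \<longleftrightarrow>
     (\<forall>x\<in>pdom \<phi> \<inter> pdom \<psi>.
        tangent_fredholm M x (Tplus \<phi> x) M x (Tplus \<psi> x)
          (\<lambda>v. pi_plus \<psi> x (piso \<phi> x (v, tzero))) \<and>
        tangent_fredholm M x (Tminus \<phi> x) M x (Tminus \<psi> x)
          (\<lambda>w. pi_minus \<psi> x (piso \<phi> x (tzero, w))) \<and>
        tangent_compact M x (Tplus \<phi> x) M x (Tminus \<psi> x)
          (\<lambda>v. pi_minus \<psi> x (piso \<phi> x (v, tzero))) \<and>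
        tangent_compact M x (Tminus \<phi> x) M x (Tplus \<psi> x)
          (\<lambda>w. pi_plus \<psi> x (piso \<phi> x (tzero, w))))"

definition compatible_pol_atlas ::
  "('m, 'e::{real_inner, complete_space, second_countable_topology}) manifold
     \<Rightarrow> ('m, 'e) pol_chart set \<Rightarrow> bool" where
  "compatible_pol_atlas M \<A> \<longleftrightarrow>
     (\<forall>\<phi>\<in>\<A>. polarizing_chart M \<phi>) \<and> \<Union> (pdom ` \<A>) = mcarrier M \<and>
     (\<forall>\<phi>\<in>\<A>. \<forall>\<psi>\<in>\<A>. pol_charts_compatible M \<phi> \<psi>)"

definition polarization ::
  "('m, 'e::{real_inner, complete_space, second_countable_topology}) manifold
     \<Rightarrow> ('m, 'e) pol_chart set \<Rightarrow> bool" where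
  "polarization M \<A> \<longleftrightarrow>
     compatible_pol_atlas M \<A> \<and>
     (\<forall>\<A>'. compatible_pol_atlas M \<A>' \<longrightarrow> \<A> \<subseteq> \<A>' \<longrightarrow> \<A>' = \<A>)"

section \<open>Floer spaces and semi-infinite cycles\<close>

record ('m, 'e) floer_data =
  fbase :: "('m, 'e) manifold"
  fweak :: "'m topology"
  fpol :: "('m, 'e) pol_chart set"
  ffun :: "'m \<Rightarrow> real"

definition floer_space ::
  "('m, 'e::{real_inner, complete_space, second_countable_topology}) floer_data \<Rightarrow> bool" where
  "floer_space F \<longleftrightarrow>
     hilbert_manifold (fbase F) \<and>
     topspace (fweak F) = mcarrier (fbase F) \<and>
     (\<forall>U. openin (fweak F) U \<longrightarrow> openin (mtop (fbase F)) U) \<and>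
     polarization (fbase F) (fpol F) \<and>
     continuous_map (mtop (fbase F)) euclideanreal (ffun F)"

definition swap_pol_chart :: "('m, 'e) pol_chart \<Rightarrow> ('m, 'e) pol_chart" where
  "swap_pol_chart \<phi> =
     \<lparr>pdom = pdom \<phi>, Tplus = Tminus \<phi>, Tminus = Tplus \<phi>,
      piso = (\<lambda>x (w, v). piso \<phi> x (v, w))\<rparr>"

definition neg_floer :: "('m, 'e) floer_data \<Rightarrow> ('m, 'e) floer_data" where
  "neg_floer F =
     \<lparr>fbase = fbase F, fweak = fweak F, fpol = swap_pol_chart ` fpol F,
      ffun = (\<lambda>x. - ffun F x)\<rparr>"

definition semi_infinite_cycle ::
  "('m, 'e::{real_inner, complete_space, second_countable_topology}) floer_data
     \<Rightarrow> ('p, 'f::{real_inner, complete_space, second_countable_topology}) manifold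
     \<Rightarrow> ('p \<Rightarrow> 'm) \<Rightarrow> bool" where
  "semi_infinite_cycle F P \<sigma> \<longleftrightarrow>
     hilbert_manifold_with_boundary P \<and>
     smooth_manifold_map P (fbase F) \<sigma> \<and>
     bdd_above (ffun F ` \<sigma> ` mcarrier P) \<and>
     (\<forall>y z. range y \<subseteq> \<sigma> ` mcarrier P \<longrightarrow> limitin (fweak F) y z sequentially \<longrightarrow>
        liminf (\<lambda>i. ereal (ffun F (y i))) \<le> ereal (ffun F z)) \<and>
     (\<forall>y. range y \<subseteq> \<sigma> ` mcarrier P \<longrightarrow> (\<exists>C. \<forall>i. \<bar>ffun F (y i)\<bar> \<le> C) \<longrightarrow>
        (\<exists>r :: nat \<Rightarrow> nat. \<exists>z. strict_mono r \<and> limitin (fweak F) (y \<circ> r) z sequentially)) \<and>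
     (\<forall>p z. range p \<subseteq> mcarrier P \<longrightarrow> limitin (fweak F) (\<sigma> \<circ> p) z sequentially \<longrightarrow>
        (\<lambda>i. ffun F (\<sigma> (p i))) \<longlonglongrightarrow> ffun F z \<longrightarrow>
        (\<exists>r :: nat \<Rightarrow> nat. \<exists>q. strict_mono r \<and> limitin (mtop P) (p \<circ> r) q sequentially)) \<and>
     (\<forall>p\<in>mcarrier P. \<forall>\<phi>\<in>fpol F. \<sigma> p \<in> pdom \<phi> \<longrightarrow>
        tangent_fredholm P p (tangent_space P p) (fbase F) (\<sigma> p) (Tminus \<phi> (\<sigma> p))
          (\<lambda>v. pi_minus \<phi> (\<sigma> p) (differential P (fbase F) \<sigma> p v)) \<and>
        tangent_compact P p (tangent_space P p) (fbase F) (\<sigma> p) (Tplus \<phi> (\<sigma> p))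
          (\<lambda>v. pi_plus \<phi> (\<sigma> p) (differential P (fbase F) \<sigma> p v)))"

end

theory Submission
  imports Defs
begin

text \<open>Write L for \<open>ffun F\<close>. Given points (p_n, q_n) of the intersection, the
  common images y_n = \<open>\<sigma>\<close> p_n = \<open>\<tau>\<close> q_n have L bounded above
  because \<open>\<sigma>\<close> is a cycle for L, and bounded below because \<open>\<tau>\<close>
  is a cycle for -L. Axiom (2) then gives a weak limit z along a subsequence, and L(y_n) may be
  taken to converge. Axiom (1), applied to both cycles, squeezes its limit to exactly L(z). Hence
  axiom (3) applies on both sides and gives strongly convergent subsequences of p_n and q_n, whose
  limits have equal images by continuity. This is sequential compactness;
  \<open>compactin_of_sequences\<close> upgrades it to compactness, since by
  \<open>second_countable_prod_topology\<close> the product is second countable.\<close>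

text \<open>Second countability reduces any open cover to a countable one. If no finite part of it
  covered, points chosen outside ever longer initial segments would form a sequence with no
  subsequence converging in \<open>S\<close>.\<close>

lemma compactin_of_sequences:
  assumes sc: "second_countable X" and S: "S \<subseteq> topspace X"
    and seq: "\<And>s. range s \<subseteq> S \<Longrightarrow>
      \<exists>(r :: nat \<Rightarrow> nat) l. strict_mono r \<and> l \<in> S \<and> limitin X (s \<circ> r) l sequentially"
  shows "compactin X S"
  unfolding compactin_def
proof (intro conjI allI impI S)
  fix \<U> assume \<U>: "(\<forall>U\<in>\<U>. openin X U) \<and> S \<subseteq> \<Union>\<U>"
  have "Lindelof_space (subtopology X S)"
    using sc by (intro second_countable_imp_Lindelof_space second_countable_subtopology)
  then have "\<exists>\<C>. countable \<C> \<and> \<C> \<subseteq> \<U> \<and> S \<subseteq> \<Union>\<C>"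
    by (rule Lindelof_space_subtopology_subset[OF S, THEN iffD1, THEN spec, THEN mp, OF _ \<U>])
  then obtain \<C> where \<C>: "countable \<C>" "\<C> \<subseteq> \<U>" "S \<subseteq> \<Union>\<C>"
    by (elim exE conjE)
  have "\<exists>\<D>. finite \<D> \<and> \<D> \<subseteq> \<C> \<and> S \<subseteq> \<Union>\<D>"
  proof (rule ccontr)
    assume none: "\<not> ?thesis"
    then have "\<C> \<noteq> {}" using \<C>(3) by blast
    \<comment> \<open>The enumeration may repeat sets, so a finite \<open>\<C>\<close> needs no
      separate case; only nonemptiness matters.\<close>
    define V where "V = from_nat_into \<C>"
    have V: "range V = \<C>"
      unfolding V_def using \<open>\<C> \<noteq> {}\<close> \<C>(1) by (rule range_from_nat_into)
    have "\<exists>x. x \<in> S \<and> x \<notin> \<Union>(V ` {..n})" for n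
    proof (rule ccontr)
      assume "\<nexists>x. x \<in> S \<and> x \<notin> \<Union>(V ` {..n})"
      then have "S \<subseteq> \<Union>(V ` {..n})" by blast
      moreover have "finite (V ` {..n})" "V ` {..n} \<subseteq> \<C>" using V by auto
      ultimately show False using none by blast
    qed
    then obtain s where s: "\<And>n. s n \<in> S" "\<And>n. s n \<notin> \<Union>(V ` {..n})" by metis
    then obtain r :: "nat \<Rightarrow> nat" and l
      where r: "strict_mono r" "l \<in> S" "limitin X (s \<circ> r) l sequentially"
      using seq[of s] by blast
    from \<C>(3) r(2) V obtain m where m: "l \<in> V m" by auto
    moreover have "openin X (V m)" using V \<C>(2) \<U> by blast
    ultimately obtain N where "\<And>n. n \<ge> N \<Longrightarrow> s (r n) \<in> V m"
      using r(3) unfolding limitin_sequentially by (metis comp_apply)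
    \<comment> \<open>The index must be at least \<open>N\<close> to lie in \<open>V m\<close>, and
      at least \<open>m\<close> so that \<open>V m\<close> is among the sets avoided by
      \<open>s\<close> at that stage.\<close>
    then have "s (r (max N m)) \<in> V m" by simp
    moreover have "m \<le> r (max N m)"
      using seq_suble[OF r(1), of "max N m"] by simp
    ultimately show False using s(2)[of "r (max N m)"] by blast
  qed
  then show "\<exists>\<F>. finite \<F> \<and> \<F> \<subseteq> \<U> \<and> S \<subseteq> \<Union>\<F>"
    using \<C>(2) by blast
qed

lemma second_countable_prod_topology:
  assumes "second_countable X" "second_countable Y"
  shows "second_countable (prod_topology X Y)"
proof -
  obtain \<B> where \<B>: "countable \<B>" "\<And>V. V \<in> \<B> \<Longrightarrow> openin X V"
    "\<And>U x. openin X U \<Longrightarrow> x \<in> U \<Longrightarrow> \<exists>V\<in>\<B>. x \<in> V \<and> V \<subseteq> U"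
    using assms(1) unfolding second_countable_def by metis
  obtain \<C> where \<C>: "countable \<C>" "\<And>V. V \<in> \<C> \<Longrightarrow> openin Y V"
    "\<And>U x. openin Y U \<Longrightarrow> x \<in> U \<Longrightarrow> \<exists>V\<in>\<C>. x \<in> V \<and> V \<subseteq> U"
    using assms(2) unfolding second_countable_def by metis
  let ?P = "(\<lambda>(U, V). U \<times> V) ` (\<B> \<times> \<C>)"
  have "countable ?P" using \<B>(1) \<C>(1) by simp
  moreover have "\<forall>W\<in>?P. openin (prod_topology X Y) W"
    using \<B>(2) \<C>(2) by (auto simp: openin_prod_Times_iff)
  moreover have "\<exists>W\<in>?P. z \<in> W \<and> W \<subseteq> U" if U: "openin (prod_topology X Y) U" "z \<in> U" for U z
  proof -
    obtain x y where z: "z = (x, y)" by (cases z)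
    obtain A B where AB: "openin X A" "openin Y B" "x \<in> A" "y \<in> B" "A \<times> B \<subseteq> U"
      using U unfolding z openin_prod_topology_alt by meson
    obtain A' where A': "A' \<in> \<B>" "x \<in> A'" "A' \<subseteq> A"
      using \<B>(3)[OF AB(1,3)] by blast
    obtain B' where B': "B' \<in> \<C>" "y \<in> B'" "B' \<subseteq> B"
      using \<C>(3)[OF AB(2,4)] by blast
    have "A' \<times> B' \<subseteq> U"
      using Sigma_mono[OF A'(3) B'(3)] AB(5) by (rule subset_trans)
    moreover have "A' \<times> B' \<in> ?P" using A'(1) B'(1) by auto
    moreover have "z \<in> A' \<times> B'" using A'(2) B'(2) unfolding z by simp
    ultimately show ?thesis by (intro bexI[of _ "A' \<times> B'"] conjI)
  qed
  ultimately have "countable ?P \<and> (\<forall>W\<in>?P. openin (prod_topology X Y) W) \<and>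
      (\<forall>U z. openin (prod_topology X Y) U \<and> z \<in> U \<longrightarrow> (\<exists>W\<in>?P. z \<in> W \<and> W \<subseteq> U))"
    by (intro conjI allI impI; (elim conjE)?)
  then show ?thesis unfolding second_countable_def by (rule exI)
qed

text \<open>Isolates the topological and energy clauses for an arbitrary \<open>F\<close>, so that
  they can be instantiated both at the given Floer space and at its negative.\<close>

lemma semi_infinite_cycle_imp:
  assumes "semi_infinite_cycle F P \<sigma>"
  shows "second_countable (mtop P)"
    and "continuous_map (mtop P) (mtop (fbase F)) \<sigma>"
    and "bdd_above (ffun F ` \<sigma> ` mcarrier P)"
    and "\<forall>y z. range y \<subseteq> \<sigma> ` mcarrier P \<longrightarrow> limitin (fweak F) y z sequentially \<longrightarrow>
      liminf (\<lambda>i. ereal (ffun F (y i))) \<le> ereal (ffun F z)"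
    and "\<forall>y. range y \<subseteq> \<sigma> ` mcarrier P \<longrightarrow> (\<exists>C. \<forall>i. \<bar>ffun F (y i)\<bar> \<le> C) \<longrightarrow>
      (\<exists>r :: nat \<Rightarrow> nat. \<exists>z. strict_mono r \<and> limitin (fweak F) (y \<circ> r) z sequentially)"
    and "\<forall>p z. range p \<subseteq> mcarrier P \<longrightarrow> limitin (fweak F) (\<sigma> \<circ> p) z sequentially \<longrightarrow>
      (\<lambda>i. ffun F (\<sigma> (p i))) \<longlonglongrightarrow> ffun F z \<longrightarrow>
      (\<exists>r :: nat \<Rightarrow> nat. \<exists>q. strict_mono r \<and> limitin (mtop P) (p \<circ> r) q sequentially)"
  using assms unfolding semi_infinite_cycle_def hilbert_manifold_with_boundary_def
    smooth_manifold_map_def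
  by - (elim conjE, assumption)+

theorem lemma4:
  fixes F :: "('m, 'e::{real_inner, complete_space, second_countable_topology}) floer_data"
    and P :: "('p, 'f::{real_inner, complete_space, second_countable_topology}) manifold"
    and Q :: "('q, 'g::{real_inner, complete_space, second_countable_topology}) manifold"
    and \<sigma> :: "'p \<Rightarrow> 'm" and \<tau> :: "'q \<Rightarrow> 'm"
  assumes "floer_space F"
    and "semi_infinite_cycle F P \<sigma>"
    and "semi_infinite_cycle (neg_floer F) Q \<tau>"
  shows "compactin (prod_topology (mtop P) (mtop Q))
           {(p, q) \<in> mcarrier P \<times> mcarrier Q. \<sigma> p = \<tau> q}"
proof (rule compactin_of_sequences)
  note P = semi_infinite_cycle_imp[OF assms(2), rule_format]
  have neg: "fbase (neg_floer F) = fbase F" "fweak (neg_floer F) = fweak F"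
    "\<And>x. ffun (neg_floer F) x = - ffun F x"
    by (simp_all add: neg_floer_def)
  \<comment> \<open>After rewriting with \<open>neg\<close>, the facts for \<open>Q\<close> speak of
    the same strong and weak topologies as those for \<open>P\<close>, with L replaced by
    -L.\<close>
  note Q = semi_infinite_cycle_imp[OF assms(3), unfolded neg, rule_format]
  have haus: "Hausdorff_space (mtop (fbase F))"
    using assms(1) unfolding floer_space_def hilbert_manifold_def
      hilbert_manifold_with_boundary_def by blast
  show "second_countable (prod_topology (mtop P) (mtop Q))"
    using P(1) Q(1) by (rule second_countable_prod_topology)
  let ?S = "{(p, q) \<in> mcarrier P \<times> mcarrier Q. \<sigma> p = \<tau> q}"
  show "?S \<subseteq> topspace (prod_topology (mtop P) (mtop Q))" by auto
  fix s :: "nat \<Rightarrow> 'p \<times> 'q"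
  assume s: "range s \<subseteq> ?S"
  define p q y where "p = fst \<circ> s" and "q = snd \<circ> s" and "y = \<sigma> \<circ> p"
  have sn: "s n \<in> ?S" for n using s by (rule range_subsetD)
  have pq: "p n \<in> mcarrier P" "q n \<in> mcarrier Q" "\<sigma> (p n) = y n" "\<tau> (q n) = y n" for n
    using sn[of n] by (auto simp: p_def q_def y_def)
  have "y n \<in> \<sigma> ` mcarrier P" "y n \<in> \<tau> ` mcarrier Q" for n
    using pq by (metis imageI)+
  then have y\<sigma>: "range (y \<circ> r) \<subseteq> \<sigma> ` mcarrier P" and y\<tau>: "range (y \<circ> r) \<subseteq> \<tau> ` mcarrier Q"
    for r :: "nat \<Rightarrow> nat"
    by auto
  \<comment> \<open>\<open>C\<close> comes from \<open>\<sigma>\<close>; \<open>D\<close> bounds -L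
    on the image of \<open>\<tau>\<close>.\<close>
  obtain C D where "\<And>n. ffun F (y n) \<le> C" "\<And>n. - ffun F (y n) \<le> D"
    using P(3) Q(3) pq unfolding bdd_above_def by (metis imageI)
  then have bound: "\<bar>ffun F (y n)\<bar> \<le> max C D" for n
    by (metis abs_le_iff max.coboundedI1 max.coboundedI2)
  obtain r1 :: "nat \<Rightarrow> nat" and z
    where r1: "strict_mono r1" "limitin (fweak F) (y \<circ> r1) z sequentially"
    using P(5)[of y] y\<sigma>[of id] bound by auto
  \<comment> \<open>Bolzano-Weierstrass makes the energies converge, so that both liminf
    inequalities concern the same number \<open>l\<close>.\<close>
  have "bounded (range (\<lambda>n. ffun F (y (r1 n))))"
    using bound by (auto simp: bounded_iff)
  then obtain l and r2 :: "nat \<Rightarrow> nat"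
    where r2: "strict_mono r2" "((\<lambda>n. ffun F (y (r1 n))) \<circ> r2) \<longlonglongrightarrow> l"
    using bounded_imp_convergent_subsequence by blast
  have weak: "limitin (fweak F) (y \<circ> (r1 \<circ> r2)) z sequentially"
    using limitin_subsequence[OF r2(1) r1(2)] by (simp add: comp_assoc)
  have lim: "(\<lambda>n. ffun F (y (r1 (r2 n)))) \<longlonglongrightarrow> l" using r2(2) by (simp add: comp_def)
  \<comment> \<open>Lower semicontinuity for \<open>L\<close> along \<open>\<sigma>\<close> and for \<open>-L\<close> along \<open>\<tau>\<close> give opposite inequalities, so
    no energy is lost in the weak limit and axiom (3) applies to both cycles.\<close>
  have liminf: "ereal l = liminf (\<lambda>n. ereal (ffun F ((y \<circ> (r1 \<circ> r2)) n)))"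
    using lim by (intro lim_imp_Liminf[symmetric]) (auto simp: comp_def)
  have le: "l \<le> ffun F z"
    using ord_eq_le_trans[OF liminf P(4)[OF y\<sigma> weak]] by simp
  have liminf_neg: "ereal (- l) = liminf (\<lambda>n. ereal (- ffun F ((y \<circ> (r1 \<circ> r2)) n)))"
    using lim by (intro lim_imp_Liminf[symmetric]) (auto simp: comp_def intro: tendsto_minus)
  have "- l \<le> - ffun F z"
    using ord_eq_le_trans[OF liminf_neg Q(4)[OF y\<tau> weak]] by simp
  with le have l: "l = ffun F z" by simp
  define r where "r = r1 \<circ> r2"
  have r: "strict_mono r" unfolding r_def using r1(1) r2(1) by (rule strict_mono_o)
  have yr: "limitin (fweak F) (y \<circ> r) z sequentially" "(\<lambda>n. ffun F (y (r n))) \<longlonglongrightarrow> ffun F z"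
    using weak lim by (simp_all add: r_def l)
  obtain r3 :: "nat \<Rightarrow> nat" and p'
    where r3: "strict_mono r3" "limitin (mtop P) (p \<circ> r \<circ> r3) p' sequentially"
    using P(6)[of "p \<circ> r" z] yr pq by (auto simp: comp_def)
  have \<tau>q: "\<tau> \<circ> (q \<circ> r \<circ> r3) = y \<circ> r \<circ> r3" and \<sigma>p: "\<sigma> \<circ> (p \<circ> r \<circ> r3) = y \<circ> r \<circ> r3"
    using pq by (auto simp: fun_eq_iff)
  have "limitin (fweak F) (\<tau> \<circ> (q \<circ> r \<circ> r3)) z sequentially"
    unfolding \<tau>q using limitin_subsequence[OF r3(1) yr(1)] .
  moreover have "(\<lambda>n. - ffun F (\<tau> ((q \<circ> r \<circ> r3) n))) \<longlonglongrightarrow> - ffun F z"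
    using tendsto_minus[OF LIMSEQ_subseq_LIMSEQ[OF yr(2) r3(1)]] pq by (simp add: comp_def)
  moreover have "range (q \<circ> r \<circ> r3) \<subseteq> mcarrier Q" using pq by auto
  \<comment> \<open>Extracting from the subsequence already chosen for \<open>p\<close> keeps both
    factors on common indices.\<close>
  ultimately obtain r4 :: "nat \<Rightarrow> nat" and q'
    where r4: "strict_mono r4" "limitin (mtop Q) (q \<circ> r \<circ> r3 \<circ> r4) q' sequentially"
    using Q(6) by blast
  have p': "limitin (mtop P) (p \<circ> r \<circ> r3 \<circ> r4) p' sequentially"
    using limitin_subsequence[OF r4(1) r3(2)] .
  \<comment> \<open>Limits are compared in the strong topology, which is Hausdorff; the weak one is
    not assumed to be.\<close>
  have "limitin (mtop (fbase F)) (\<sigma> \<circ> (p \<circ> r \<circ> r3 \<circ> r4)) (\<sigma> p') sequentially"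
    using P(2) p' by (rule continuous_map_limit)
  moreover have "limitin (mtop (fbase F)) (\<tau> \<circ> (q \<circ> r \<circ> r3 \<circ> r4)) (\<tau> q') sequentially"
    using Q(2) r4(2) by (rule continuous_map_limit)
  moreover have "\<sigma> \<circ> (p \<circ> r \<circ> r3 \<circ> r4) = \<tau> \<circ> (q \<circ> r \<circ> r3 \<circ> r4)"
    using pq by (auto simp: fun_eq_iff)
  ultimately have "\<sigma> p' = \<tau> q'"
    using limitin_Hausdorff_unique[OF _ _ trivial_limit_sequentially haus] by metis
  then have "(p', q') \<in> ?S"
    using p' r4(2) by (auto dest: limitin_topspace)
  moreover have "limitin (prod_topology (mtop P) (mtop Q)) (s \<circ> (r \<circ> r3 \<circ> r4)) (p', q') sequentially"
    using p' r4(2) by (simp add: limitin_pairwise p_def q_def comp_assoc)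
  moreover have "strict_mono (r \<circ> r3 \<circ> r4)"
    using r r3(1) r4(1) by (intro strict_mono_o)
  ultimately show "\<exists>(r :: nat \<Rightarrow> nat) l. strict_mono r \<and> l \<in> ?S \<and>
      limitin (prod_topology (mtop P) (mtop Q)) (s \<circ> r) l sequentially"
    by blast
qed

end
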